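(* Let $T$ be a finite set (of rule templates) and let $\tau \in T^{\mathbb{Z}}$ be a non-recurrent rule distribution template. Then there exist a finite set $\mathcal{R}$ of local rules (with some common finite state set $\Sigma$ and common neighbourhood $N$ in $\mathbb{Z}$) and an assignment $\alpha : T \to \mathcal{R}$ such that the global update rule $H_{\tau_\alpha}:\Sigma^{\mathbb{Z}}\to\Sigma^{\mathbb{Z}}$ is pre-injective but not surjective.
   Context: A neighbourhood is a tuple $N = (n_1,\ldots,n_m)$ of integers. A local rule with finite state set $\Sigma$ and neighbourhood $N$ is a function $f:\Sigma^m \to \Sigma$. A rule distribution is $\theta \in \mathcal{R}^{\mathbb{Z}}$, where $\mathcal{R}$ is a finite set of local rules with the same state set $\Sigma$ and neighbourhood $N$. Its global update rule is $H_\theta:\Sigma^{\mathbb{Z}}\to\Sigma^{\mathbb{Z}}$, $$H_\theta(c)(x) = \theta(x)\big(c(x+n_1),\ldots,c(x+n_m)\big)\quad\text{for all } x \in \mathbb{Z}.$$ A rule distribution template is a configuration $\tau\in T^{\mathbb{Z}}$ over a finite set $T$ of rule templates (abstract symbols). An assignment of local rules is a function $\alpha:T\to\mathcal{R}$; the rule distribution $\tau_\alpha\in\mathcal{R}^{\mathbb{Z}}$ is given by $\tau_\alpha(x)=\alpha(\tau(x))$. Two configurations $c,e\in\Sigma^{\mathbb{Z}}$ are asymptotic if $\{x : c(x)\neq e(x)\}$ is finite. $H_\theta$ is pre-injective if $H_\theta(c)\neq H_\theta(e)$ for all asymptotic $c,e$ with $c \neq e$. A configuration $c$ is recurrent if every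 finite pattern that appears in it appears at least twice: for every nonempty finite $D\subseteq\mathbb{Z}$ there is $r\in\mathbb{Z}$, $r\neq 0$, such that $c(x+r)=c(x)$ for all $x\in D$. Non-recurrent means not recurrent. *)

theory Defs
  imports "HOL-Library.FuncSet"
begin

text \<open>
  State sets are explicit carrier sets, so that they can be quantified over.
  A neighbourhood is a list of integers; a tuple of states is a list of the same length.
\<close>

type_synonym 's config = "int \<Rightarrow> 's"
type_synonym neighbourhood = "int list"
type_synonym 's local_rule = "'s list \<Rightarrow> 's"

definition configs :: "'s set \<Rightarrow> 's config set" where
  "configs \<Sigma> = UNIV \<rightarrow> \<Sigma>"

text \<open>
  Extensionality makes two local rules equal iff they agree on all tuples over the state set.
\<close>

definition local_rules :: "'s set \<Rightarrow> neighbourhood \<Rightarrow> 's local_rule set" where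
  "local_rules \<Sigma> N = {w. set w \<subseteq> \<Sigma> \<and> length w = length N} \<rightarrow>\<^sub>E \<Sigma>"

definition global_update ::
    "neighbourhood \<Rightarrow> (int \<Rightarrow> 's local_rule) \<Rightarrow> 's config \<Rightarrow> 's config" where
  "global_update N \<theta> c = (\<lambda>x. \<theta> x (map (\<lambda>n. c (x + n)) N))"

definition rule_distribution ::
    "('t \<Rightarrow> 's local_rule) \<Rightarrow> 't config \<Rightarrow> int \<Rightarrow> 's local_rule" where
  "rule_distribution \<alpha> \<tau> = (\<lambda>x. \<alpha> (\<tau> x))"

definition asymptotic :: "'s config \<Rightarrow> 's config \<Rightarrow> bool" where
  "asymptotic c e \<longleftrightarrow> finite {x. c x \<noteq> e x}"

definition pre_injective :: "'s set \<Rightarrow> ('s config \<Rightarrow> 's config) \<Rightarrow> bool" where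
  "pre_injective \<Sigma> H \<longleftrightarrow>
     (\<forall>c\<in>configs \<Sigma>. \<forall>e\<in>configs \<Sigma>. asymptotic c e \<and> c \<noteq> e \<longrightarrow> H c \<noteq> H e)"

definition surjective :: "'s set \<Rightarrow> ('s config \<Rightarrow> 's config) \<Rightarrow> bool" where
  "surjective \<Sigma> H \<longleftrightarrow> H ` configs \<Sigma> = configs \<Sigma>"

definition recurrent :: "'t config \<Rightarrow> bool" where
  "recurrent c \<longleftrightarrow>
     (\<forall>D. finite D \<and> D \<noteq> {} \<longrightarrow> (\<exists>r. r \<noteq> 0 \<and> (\<forall>x\<in>D. c (x + r) = c x)))"

lemma global_update_in_configs:
  assumes "\<And>x. \<theta> x \<in> local_rules \<Sigma> N" and "c \<in> configs \<Sigma>"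
  shows "global_update N \<theta> c \<in> configs \<Sigma>"
proof -
  have "\<theta> x (map (\<lambda>n. c (x + n)) N) \<in> \<Sigma>" for x
    using assms(1)[of x] assms(2) unfolding local_rules_def configs_def
    by (intro PiE_mem[of "\<theta> x"]) (auto simp: Pi_iff)
  then show ?thesis
    by (simp add: global_update_def configs_def)
qed

end

theory Submission
  imports Defs "HOL-Library.Nat_Bijection"
begin

text \<open>
  Let \<open>d\<^sub>0, \<dots>, d\<^sub>m\<^sub>-\<^sub>1\<close> enumerate a finite set whose pattern in \<open>\<tau>\<close> occurs only at
  the origin, and let the states be vectors in \<open>(\<int>/2\<int>)\<^sup>m\<close>. First apply the exclusive-or automaton
  \<open>v(y) = c(y) + c(y + 1)\<close>. Then the cell \<open>y + d\<^sub>i\<close>, which knows only its own template, outputs in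
  coordinate \<open>i\<close> either \<open>v\<^sub>i(y)\<close> or, if its template is \<open>\<tau>(d\<^sub>i)\<close>, the sum \<open>v\<^sub>i(y) + v\<^sub>i\<^sub>+\<^sub>1(y)\<close> with
  indices modulo \<open>m\<close>. If some template around \<open>y\<close> differs from the pattern, these outputs determine
  \<open>v(y)\<close>; only at \<open>y = 0\<close> is information lost, where the outputs sum to zero. So the map is not
  surjective. A finite difference of two configurations with the same image satisfies
  \<open>\<delta>(y) = \<delta>(y + 1)\<close> for all \<open>y \<noteq> 0\<close>, hence it vanishes.
\<close>

text \<open>The step leads from \<open>k\<close> down to 0, wraps around from 0 to
  \<open>m - 1\<close>, and then leads down to any \<open>i\<close>.\<close>

lemma cyclic_backward_induct:
  fixes i k m :: nat
  assumes step: "\<And>i. i < m \<Longrightarrow> Q (Suc i mod m) \<Longrightarrow> Q i"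
    and "k < m" "Q k" "i < m"
  shows "Q i"
proof -
  have down: "Q j" if "n < m" "Q n" "j \<le> n" for n j
    using \<open>j \<le> n\<close> that(1,2)
  proof (induction j rule: inc_induct)
    case base
    then show ?case by simp
  next
    case (step j)
    then show ?case
      using assms(1)[of j] by simp
  qed
  have "Q 0"
    using down[OF \<open>k < m\<close> \<open>Q k\<close>] by simp
  then have "Q (m - 1)"
    using \<open>k < m\<close> step[of "m - 1"] by simp
  then show ?thesis
    using down[of "m - 1" i] \<open>i < m\<close> by simp
qed

text \<open>Only the link between 0 and 1 is missing, so one element puts a whole ray into
  \<open>S\<close>: upwards if it is positive, downwards otherwise.\<close>

lemma finite_int_set_shift_except_0_empty:
  fixes S :: "int set"
  assumes fin: "finite S" and shift: "\<And>y. y \<noteq> 0 \<Longrightarrow> y \<in> S \<longleftrightarrow> y + 1 \<in> S"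
  shows "S = {}"
proof (rule ccontr)
  assume "S \<noteq> {}"
  then obtain x where x: "x \<in> S" by blast
  show False
  proof (cases "x > 0")
    case True
    have "y \<in> S" if "x \<le> y" for y
      using that
    proof (induction y rule: int_ge_induct)
      case base
      then show ?case by (rule x)
    next
      case (step y)
      then show ?case using shift[of y] True by simp
    qed
    then have "{x..} \<subseteq> S" by auto
    then show False
      using fin infinite_Ici finite_subset by blast
  next
    case False
    have "y \<in> S" if "y \<le> x" for y
      using that
    proof (induction y rule: int_le_induct)
      case base
      then show ?case by (rule x)
    next
      case (step y)
      then show ?case using shift[of "y - 1"] False by simp
    qed
    then have "{..x} \<subseteq> S" by auto
    then show False
      using fin infinite_Iic finite_subset by blast
  qed
qed

text \<open>A vector in \<open>(\<int>/2\<int>)\<^sup>m\<close> is represented by the code of its support.\<close>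

definition states :: "nat \<Rightarrow> nat set" where
  "states m = set_encode ` Pow {..<m}"

lemma finite_states: "finite (states m)"
  by (simp add: states_def)

lemma set_encode_in_states: "A \<subseteq> {..<m} \<Longrightarrow> set_encode A \<in> states m"
  by (simp add: states_def)

lemma set_decode_states: "s \<in> states m \<Longrightarrow> set_decode s \<subseteq> {..<m}"
  by (auto simp: states_def finite_subset[OF _ finite_lessThan] dest: subsetD)

text \<open>Seen from the cell \<open>y + ds ! i\<close>, entry \<open>i\<close> of the first half
  is the cell \<open>y\<close>, and entry \<open>i\<close> of the second half is
  \<open>y + 1\<close>.\<close>

definition nbhd :: "int list \<Rightarrow> neighbourhood" where
  "nbhd ds = map (\<lambda>d. - d) ds @ map (\<lambda>d. 1 - d) ds"

definition xor_at :: "nat \<Rightarrow> nat list \<Rightarrow> nat \<Rightarrow> nat \<Rightarrow> bool" where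
  "xor_at m w i j \<longleftrightarrow> (j \<in> set_decode (w ! i)) \<noteq> (j \<in> set_decode (w ! (m + i)))"

text \<open>A cell \<open>x\<close> serves every \<open>i\<close> at once: coordinate
  \<open>i\<close> of its output concerns \<open>y = x - ds ! i\<close>.\<close>

definition template_rule :: "'t config \<Rightarrow> int list \<Rightarrow> 't \<Rightarrow> nat local_rule" where
  "template_rule \<tau> ds t = (let m = length ds in
     restrict
       (\<lambda>w. set_encode {i. i < m \<and>
          xor_at m w i i \<noteq> (t = \<tau> (ds ! i) \<and> xor_at m w i (Suc i mod m))})
       {w. set w \<subseteq> states m \<and> length w = length (nbhd ds)})"

lemma template_rule_in_local_rules:
  "template_rule \<tau> ds t \<in> local_rules (states (length ds)) (nbhd ds)"
  unfolding template_rule_def local_rules_def Let_def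
  by (intro restrict_PiE_iff[THEN iffD2] ballI set_encode_in_states) auto

definition xor_next :: "nat config \<Rightarrow> int \<Rightarrow> nat \<Rightarrow> bool" where
  "xor_next c y j \<longleftrightarrow> (j \<in> set_decode (c y)) \<noteq> (j \<in> set_decode (c (y + 1)))"

lemma set_decode_global_update:
  assumes "c \<in> configs (states (length ds))" "i < length ds"
  shows "i \<in> set_decode (global_update (nbhd ds) (rule_distribution (template_rule \<tau> ds) \<tau>) c (y + ds ! i))
    \<longleftrightarrow> xor_next c y i \<noteq>
          (\<tau> (y + ds ! i) = \<tau> (ds ! i) \<and> xor_next c y (Suc i mod length ds))"
proof -
  let ?m = "length ds"
  let ?w = "map (\<lambda>n. c (y + ds ! i + n)) (nbhd ds)"
  have w: "set ?w \<subseteq> states ?m" "length ?w = length (nbhd ds)"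
    using assms(1) by (auto simp: configs_def)
  have "xor_at ?m ?w i j \<longleftrightarrow> xor_next c y j" for j
    using assms(2) by (simp add: xor_at_def xor_next_def nbhd_def nth_append algebra_simps)
  then show ?thesis
    using w assms(2) by (simp add: global_update_def rule_distribution_def template_rule_def Let_def)
qed

lemma pre_injective_template_rule:
  assumes unique: "\<And>r. r \<noteq> 0 \<Longrightarrow> \<exists>x\<in>set ds. \<tau> (x + r) \<noteq> \<tau> x"
  shows "pre_injective (states (length ds))
           (global_update (nbhd ds) (rule_distribution (template_rule \<tau> ds) \<tau>))"
  unfolding pre_injective_def
proof (intro ballI impI notI)
  let ?m = "length ds"
  let ?H = "global_update (nbhd ds) (rule_distribution (template_rule \<tau> ds) \<tau>)"
  fix c e
  assume c: "c \<in> configs (states ?m)" and e: "e \<in> configs (states ?m)"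
    and ce: "asymptotic c e \<and> c \<noteq> e" and H: "?H c = ?H e"
  have next_eq: "xor_next c y j \<longleftrightarrow> xor_next e y j" if y: "y \<noteq> 0" and j: "j < ?m" for y j
  proof -
    \<comment> \<open>At \<open>y + ds ! k\<close> the template test fails, so the output reveals
      coordinate \<open>k\<close> itself; this starts the cyclic induction.\<close>
    obtain k where k: "k < ?m" "\<tau> (y + ds ! k) \<noteq> \<tau> (ds ! k)"
      using unique[OF y] by (auto simp: in_set_conv_nth add.commute)
    show ?thesis
    proof (rule cyclic_backward_induct[where Q = "\<lambda>j. xor_next c y j \<longleftrightarrow> xor_next e y j",
          OF _ k(1) _ j])
      show "xor_next c y k \<longleftrightarrow> xor_next e y k"
        using set_decode_global_update[OF c k(1), of \<tau> y]
          set_decode_global_update[OF e k(1), of \<tau> y] H k(2) by simp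
    next
      \<comment> \<open>The template test has the same outcome for \<open>c\<close> and
        \<open>e\<close>, so equal outputs and equal coordinates at the successor of
        \<open>i\<close> force equality at \<open>i\<close>.\<close>
      fix i
      assume "i < ?m" "xor_next c y (Suc i mod ?m) \<longleftrightarrow> xor_next e y (Suc i mod ?m)"
      then show "xor_next c y i \<longleftrightarrow> xor_next e y i"
        using set_decode_global_update[OF c, of i \<tau> y]
          set_decode_global_update[OF e, of i \<tau> y] H by auto
    qed
  qed
  have agree: "j \<in> set_decode (c x) \<longleftrightarrow> j \<in> set_decode (e x)" if j: "j < ?m" for x j
  proof -
    let ?S = "{x. (j \<in> set_decode (c x)) \<noteq> (j \<in> set_decode (e x))}"
    have "?S \<subseteq> {x. c x \<noteq> e x}" by auto
    then have "finite ?S"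
      using ce finite_subset by (auto simp: asymptotic_def)
    moreover have "y \<in> ?S \<longleftrightarrow> y + 1 \<in> ?S" if "y \<noteq> 0" for y
      using next_eq[OF that j] by (auto simp: xor_next_def)
    ultimately have "?S = {}"
      by (rule finite_int_set_shift_except_0_empty)
    then show ?thesis by blast
  qed
  have "c x = e x" for x
  proof -
    have "c x \<in> states ?m" "e x \<in> states ?m"
      using c e by (auto simp: configs_def)
    then have "set_decode (c x) = set_decode (e x)"
      using agree set_decode_states by blast
    then show ?thesis
      by (metis set_decode_inverse)
  qed
  then show False
    using ce by auto
qed

lemma not_surjective_template_rule:
  assumes "ds \<noteq> []"
  shows "\<not> surjective (states (length ds))
           (global_update (nbhd ds) (rule_distribution (template_rule \<tau> ds) \<tau>))"
proof
  let ?m = "length ds"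
  let ?H = "global_update (nbhd ds) (rule_distribution (template_rule \<tau> ds) \<tau>)"
  assume surj: "surjective (states ?m) ?H"
  have m: "0 < ?m" using assms by simp
  \<comment> \<open>A single 1, in coordinate 0 of the cell \<open>ds ! 0\<close>, makes the outputs
    that concern \<open>y = 0\<close> sum to 1.\<close>
  define e :: "nat config" where "e = (\<lambda>x. set_encode (if x = ds ! 0 then {0} else {}))"
  have "e \<in> configs (states ?m)"
    using m by (simp add: e_def configs_def set_encode_in_states)
  then obtain c where c: "c \<in> configs (states ?m)" and e: "?H c = e"
    using surj unfolding surjective_def by (metis imageE)
  \<comment> \<open>At \<open>y = 0\<close> every template test succeeds, so every output is a sum
    of two cyclically adjacent coordinates.\<close>
  have *: "xor_next c 0 i \<noteq> xor_next c 0 (Suc i mod ?m) \<longleftrightarrow> i = 0" if "i < ?m" for i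
  proof -
    have "i \<in> set_decode (e (ds ! i)) \<longleftrightarrow> i = 0"
      by (cases "i = 0") (auto simp: e_def simp del: set_encode_insert)
    then show ?thesis
      using set_decode_global_update[OF c that, of \<tau> 0] unfolding e by simp
  qed
  have "xor_next c 0 i \<longleftrightarrow> xor_next c 0 0" if "i < ?m" for i
  proof (rule cyclic_backward_induct[where Q = "\<lambda>i. xor_next c 0 i \<longleftrightarrow> xor_next c 0 0",
        OF _ m refl that])
    fix i
    assume "i < ?m" "xor_next c 0 (Suc i mod ?m) \<longleftrightarrow> xor_next c 0 0"
    then show "xor_next c 0 i \<longleftrightarrow> xor_next c 0 0"
      using *[of i] by auto
  qed
  \<comment> \<open>Going round the cycle without passing the link at 0 makes all coordinates equal,
    whereas that link demands a difference. For \<open>?m = 1\<close> it compares coordinate 0 with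
    itself.\<close>
  from this[of "Suc 0 mod ?m"] *[OF m] m show False
    by simp
qed

theorem theorem3:
  fixes T :: "'t set" and \<tau> :: "'t config"
  assumes "finite T" and "\<tau> \<in> configs T" and "\<not> recurrent \<tau>"
  shows "\<exists>(\<Sigma> :: nat set) (N :: neighbourhood) (R :: nat local_rule set) (\<alpha> :: 't \<Rightarrow> nat local_rule).
           finite \<Sigma> \<and> finite R \<and> R \<subseteq> local_rules \<Sigma> N \<and> \<alpha> \<in> T \<rightarrow> R \<and>
           pre_injective \<Sigma> (global_update N (rule_distribution \<alpha> \<tau>)) \<and>
           \<not> surjective \<Sigma> (global_update N (rule_distribution \<alpha> \<tau>))"
proof -
  obtain D where D: "finite D" "D \<noteq> {}" "\<And>r. r \<noteq> 0 \<Longrightarrow> \<exists>x\<in>D. \<tau> (x + r) \<noteq> \<tau> x"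
    using \<open>\<not> recurrent \<tau>\<close> unfolding recurrent_def by auto
  obtain ds where ds: "set ds = D"
    using finite_list[OF D(1)] by blast
  show ?thesis
  proof (intro exI conjI)
    show "finite (states (length ds))"
      by (rule finite_states)
    show "finite (template_rule \<tau> ds ` T)"
      using \<open>finite T\<close> by simp
    show "template_rule \<tau> ds ` T \<subseteq> local_rules (states (length ds)) (nbhd ds)"
      by (intro image_subsetI template_rule_in_local_rules)
    show "template_rule \<tau> ds \<in> T \<rightarrow> template_rule \<tau> ds ` T"
      by auto
    show "pre_injective (states (length ds))
            (global_update (nbhd ds) (rule_distribution (template_rule \<tau> ds) \<tau>))"
      using D(3) ds by (intro pre_injective_template_rule) auto
    show "\<not> surjective (states (length ds))
            (global_update (nbhd ds) (rule_distribution (template_rule \<tau> ds) \<tau>))"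
      using D(2) ds by (intro not_surjective_template_rule) auto
  qed
qed

end
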